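(* Let $T$ be bounded with a positive bidiagonal factorization and let $\nu^{-\top}=\mathscr L\mathscr C$ with $\mathscr C\in\mathbb R^{p\times p}$ entrywise nonnegative and upper unitriangular. Let $N\ge p-1$ and let $\mathcal N=N+1$ be the number of nodes. Then for $a\in\{1,\dots,p\}$ the degrees of precision are $$d_a(N)=\mathcal N-1+\left\lceil\frac{\mathcal N+1-a}{p}\right\rceil .$$
   Context: Fix an integer $p\ge 1$; $\mathbb N_0=\{0,1,2,\dots\}$. $T=(T_{i,j})_{i,j\ge 0}$ is a real semi-infinite monic banded lower Hessenberg matrix: $T_{n,n+1}=1$ for all $n\ge0$, $T_{i,j}=0$ if $j>i+1$ or $j<i-p$, and $T_{n,n-p}\neq0$ for $n\ge p$. Bounded means $\|T\|_\infty=\sup_i\sum_j|T_{i,j}|<\infty$. $T^{[N]}=(T_{i,j})_{0\le i,j\le N}$. $\nu$ is a real lower unitriangular $p\times p$ matrix, $\nu^{-\top}=(\nu^{-1})^\top$. Positive bidiagonal factorization: $T=L_1\cdots L_pU$, where $L_k$ is lower bidiagonal with unit diagonal and $(L_k)_{j+1,j}=\alpha_{k+1+j(p+1)}$, $U$ is upper bidiagonal with unit superdiagonal and $U_{j,j}=\alpha_{1+j(p+1)}$ ($j\in\mathbb N_0$), and $\alpha_i>0$ for all $i\ge1$. The matrix $\mathscr L=[\mathscr L_1\ \cdots\ \mathscr L_p]\in\mathbb R^{p\times p}$ has columns $\mathscr L_1=(1,0,\dots,0)^\top$ and, for $2\le k\le p$, $\mathscr L_k=\frac1{d_k}L_1^{[p-1]}\cdots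 L_{k-1}^{[p-1]}(1,0,\dots,0)^\top$ with the normalizing constant $d_k=\alpha_k\alpha_{k+p}\alpha_{k+2p}\cdots\alpha_{k+(k-2)p}$, where $L_i^{[p-1]}$ is the leading $p\times p$ principal submatrix of $L_i$ (these constants $d_k$ are unrelated to the degrees of precision $d_a(N)$). $e_1$ is the first canonical vector, and $e_a^\nu$ is the vector $\nu^{-\top}e_a\in\mathbb R^p$ ($e_a$ canonical in $\mathbb R^p$) extended by zeros (to length $N+1$, or to a semi-infinite vector). The degree of precision $d_a(N)$ is the largest natural number such that $e_1^\top T^ne_a^\nu=e_1^\top(T^{[N]})^ne_a^\nu$ for all $0\le n\le d_a(N)$. $\lceil x\rceil$ is the least integer $\ge x$. *)

theory Defs
  imports Complex_Main "Jordan_Normal_Form.Gauss_Jordan_Elimination"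
begin

text \<open>
  Semi-infinite real matrices and vectors are functions on \<^typ>\<open>nat\<close>; finite ones are those of
  \<^theory>\<open>Jordan_Normal_Form.Matrix\<close>. Rows and columns of matrices and entries of vectors are
  numbered from 0, whereas the indices \<open>a\<close>, \<open>k\<close> and the indices of \<open>\<alpha>\<close> start from 1
  (so \<open>\<alpha> 0\<close> is never used).
\<close>

type_synonym smat = "nat \<Rightarrow> nat \<Rightarrow> real"
type_synonym svec = "nat \<Rightarrow> real"

text \<open>
  For the banded matrices considered here, each of the following series has only finitely many
  nonzero terms.
\<close>

definition smat_mult :: "smat \<Rightarrow> smat \<Rightarrow> smat" where
  "smat_mult A B = (\<lambda>i j. \<Sum>k. A i k * B k j)"

definition smat_one :: smat where
  "smat_one = (\<lambda>i j. if i = j then 1 else 0)"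

primrec smat_power :: "smat \<Rightarrow> nat \<Rightarrow> smat" where
  "smat_power A 0 = smat_one"
| "smat_power A (Suc n) = smat_mult (smat_power A n) A"

definition smat_mult_vec :: "smat \<Rightarrow> svec \<Rightarrow> svec" where
  "smat_mult_vec A v = (\<lambda>i. \<Sum>j. A i j * v j)"

definition svec_scalar_prod :: "svec \<Rightarrow> svec \<Rightarrow> real" where
  "svec_scalar_prod u v = (\<Sum>i. u i * v i)"

definition sunit_vec :: "nat \<Rightarrow> svec" where
  "sunit_vec i = (\<lambda>j. if j = i then 1 else 0)"

definition leading_submatrix :: "smat \<Rightarrow> nat \<Rightarrow> real mat" where
  "leading_submatrix A m = mat (Suc m) (Suc m) (\<lambda>(i, j). A i j)"

definition monic_banded_Hessenberg :: "nat \<Rightarrow> smat \<Rightarrow> bool" where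
  "monic_banded_Hessenberg p T \<longleftrightarrow>
     (\<forall>n. T n (n + 1) = 1) \<and>
     (\<forall>i j. j > i + 1 \<or> j + p < i \<longrightarrow> T i j = 0) \<and>
     (\<forall>n\<ge>p. T n (n - p) \<noteq> 0)"

definition bounded_smat :: "smat \<Rightarrow> bool" where
  "bounded_smat T \<longleftrightarrow>
     (\<forall>i. summable (\<lambda>j. \<bar>T i j\<bar>)) \<and> bdd_above (range (\<lambda>i. \<Sum>j. \<bar>T i j\<bar>))"

definition L_factor :: "nat \<Rightarrow> (nat \<Rightarrow> real) \<Rightarrow> nat \<Rightarrow> smat" where
  "L_factor p \<alpha> k = (\<lambda>i j. if i = j then 1
                           else if i = j + 1 then \<alpha> (k + 1 + j * (p + 1))
                           else 0)"

definition U_factor :: "nat \<Rightarrow> (nat \<Rightarrow> real) \<Rightarrow> smat" where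
  "U_factor p \<alpha> = (\<lambda>i j. if i = j then \<alpha> (1 + j * (p + 1))
                         else if j = i + 1 then 1
                         else 0)"

definition positive_bidiagonal_factorization :: "nat \<Rightarrow> smat \<Rightarrow> (nat \<Rightarrow> real) \<Rightarrow> bool" where
  "positive_bidiagonal_factorization p T \<alpha> \<longleftrightarrow>
     (\<forall>i\<ge>1. \<alpha> i > 0) \<and>
     T = foldr smat_mult (map (L_factor p \<alpha>) [1..<p + 1]) (U_factor p \<alpha>)"

text \<open>
  The column of index \<open>k\<close> of \<open>\<L>\<close> is given by one formula for all \<open>1 \<le> k \<le> p\<close>: for \<open>k = 1\<close> both
  products are empty and it is the first canonical vector.
\<close>

definition scriptL_norm :: "nat \<Rightarrow> (nat \<Rightarrow> real) \<Rightarrow> nat \<Rightarrow> real" where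
  "scriptL_norm p \<alpha> k = (\<Prod>i<k - 1. \<alpha> (k + i * p))"

definition scriptL_col :: "nat \<Rightarrow> (nat \<Rightarrow> real) \<Rightarrow> nat \<Rightarrow> real vec" where
  "scriptL_col p \<alpha> k =
     (1 / scriptL_norm p \<alpha> k) \<cdot>\<^sub>v
       (foldr (*) (map (\<lambda>i. leading_submatrix (L_factor p \<alpha> i) (p - 1)) [1..<k]) (1\<^sub>m p)
         *\<^sub>v unit_vec p 0)"

definition scriptL :: "nat \<Rightarrow> (nat \<Rightarrow> real) \<Rightarrow> real mat" where
  "scriptL p \<alpha> = mat_of_cols p (map (scriptL_col p \<alpha>) [1..<p + 1])"

definition upper_unitriangular :: "nat \<Rightarrow> real mat \<Rightarrow> bool" where
  "upper_unitriangular p A \<longleftrightarrow>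
     A \<in> carrier_mat p p \<and> upper_triangular A \<and> (\<forall>i<p. A $$ (i, i) = 1)"

definition lower_unitriangular :: "nat \<Rightarrow> real mat \<Rightarrow> bool" where
  "lower_unitriangular p A \<longleftrightarrow> upper_unitriangular p (transpose_mat A)"

definition nonnegative_mat :: "real mat \<Rightarrow> bool" where
  "nonnegative_mat A \<longleftrightarrow> (\<forall>i<dim_row A. \<forall>j<dim_col A. A $$ (i, j) \<ge> 0)"

text \<open>The option is never \<^const>\<open>None\<close> for the invertible matrices this is applied to.\<close>

definition inverse_transpose :: "real mat \<Rightarrow> real mat" where
  "inverse_transpose A = transpose_mat (the (mat_inverse A))"

definition e_nu :: "nat \<Rightarrow> real mat \<Rightarrow> nat \<Rightarrow> svec" where
  "e_nu p \<nu> a = (\<lambda>i. if i < p then (inverse_transpose \<nu> *\<^sub>v unit_vec p (a - 1)) $ i else 0)"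

definition moment :: "nat \<Rightarrow> smat \<Rightarrow> real mat \<Rightarrow> nat \<Rightarrow> nat \<Rightarrow> real" where
  "moment p T \<nu> a n =
     svec_scalar_prod (sunit_vec 0) (smat_mult_vec (smat_power T n) (e_nu p \<nu> a))"

definition truncated_moment ::
    "nat \<Rightarrow> smat \<Rightarrow> real mat \<Rightarrow> nat \<Rightarrow> nat \<Rightarrow> nat \<Rightarrow> real" where
  "truncated_moment p T \<nu> N a n =
     unit_vec (N + 1) 0 \<bullet> ((leading_submatrix T N ^\<^sub>m n) *\<^sub>v vec (N + 1) (e_nu p \<nu> a))"

text \<open>
  A relation rather than a function: it also asserts that the largest such number exists.
\<close>

definition is_degree_of_precision ::
    "nat \<Rightarrow> smat \<Rightarrow> real mat \<Rightarrow> nat \<Rightarrow> nat \<Rightarrow> nat \<Rightarrow> bool" where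
  "is_degree_of_precision p T \<nu> N a d \<longleftrightarrow>
     (\<forall>n\<le>d. moment p T \<nu> a n = truncated_moment p T \<nu> N a n) \<and>
     (\<forall>d'. (\<forall>n\<le>d'. moment p T \<nu> a n = truncated_moment p T \<nu> N a n) \<longrightarrow> d' \<le> d)"

end

theory Submission
  imports Defs
begin

text \<open>
  The proof counts weighted lattice paths. The entry of row \<open>0\<close> and column \<open>j\<close> of \<open>T\<^sup>n\<close> is a sum
  over paths of \<open>n\<close> steps from site \<open>0\<close> to site \<open>j\<close>, in which a step goes up by at most one or down
  by at most \<open>p\<close>. Truncating \<open>T\<close> discards exactly the paths that visit a site beyond \<open>N\<close>. The
  shortest such path to \<open>j \<le> N\<close> climbs straight to site \<open>N + 1\<close> in \<open>N + 1\<close> steps and then descends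
  with steps of size \<open>p\<close> as far as possible, so that \<open>n p + j \<ge> (N + 1) (p + 1)\<close> for every
  discarded path of \<open>n\<close> steps to \<open>j\<close>. Hence for smaller \<open>n\<close> nothing is lost
  (\<open>truncation_defect_eq_0\<close>). The moment of index \<open>a\<close> weights the end points by the
  column \<open>a\<close> of \<open>\<nu>\<^sup>-\<^sup>\<top>\<close>, which is supported on the sites below \<open>a\<close>; taking
  \<open>j = a - 1\<close> gives the number of steps up to which the two moments agree.

  That they disagree one step later is where positivity enters. The factorization makes every entry
  of the band of \<open>T\<close> strictly positive (\<open>band_of_bidiagonal_product\<close>), so each discarded path has
  positive weight (\<open>truncation_defect_pos\<close>). Likewise \<open>\<L> \<C>\<close> is nonnegative with a
  positive diagonal (\<open>scriptL_entry\<close>), so the contributions of the various end points cannot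
  cancel, and that of \<open>a - 1\<close> does not vanish.
\<close>

section \<open>Positivity of the band of a bidiagonal product\<close>

lemma smat_mult_eq_sum:
  assumes "finite S" "\<And>k. k \<notin> S \<Longrightarrow> A i k * B k j = 0"
  shows "smat_mult A B i j = (\<Sum>k\<in>S. A i k * B k j)"
  unfolding smat_mult_def using assms by (intro suminf_finite) auto

lemma smat_mult_L_factor:
  "smat_mult (L_factor p \<alpha> k) M i j =
     M i j + (if i = 0 then 0 else \<alpha> (k + 1 + (i - 1) * (p + 1)) * M (i - 1) j)"
proof -
  have "smat_mult (L_factor p \<alpha> k) M i j = (\<Sum>l\<in>{i, i - 1}. L_factor p \<alpha> k i l * M l j)"
    by (rule smat_mult_eq_sum) (auto simp: L_factor_def split: if_splits)
  then show ?thesis by (cases i) (auto simp: L_factor_def)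
qed

text \<open>
  Left multiplication by a lower bidiagonal factor adds to each row a positive multiple of the
  previous one. The band therefore grows downwards by one diagonal, and since all summands are
  nonnegative no entry of it can vanish.
\<close>

lemma band_of_bidiagonal_product:
  fixes \<alpha> :: "nat \<Rightarrow> real" and p :: nat
  assumes pos: "\<And>i. i \<ge> 1 \<Longrightarrow> \<alpha> i > 0"
  defines "M \<equiv> \<lambda>ks. foldr smat_mult (map (L_factor p \<alpha>) ks) (U_factor p \<alpha>)"
  shows "if j \<le> i + 1 \<and> i \<le> j + length ks then M ks i j > 0 else M ks i j = 0"
proof (induction ks arbitrary: i)
  case Nil
  show ?case by (auto simp: M_def U_factor_def pos)
next
  case (Cons k ks)
  have rec: "M (k # ks) i j =
      M ks i j + (if i = 0 then 0 else \<alpha> (k + 1 + (i - 1) * (p + 1)) * M ks (i - 1) j)"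
    by (simp add: M_def smat_mult_L_factor)
  have nonneg: "M ks i j \<ge> 0" for i
    using Cons[of i] by (auto split: if_splits)
  have c: "\<alpha> (k + 1 + (i - 1) * (p + 1)) > 0" by (rule pos) simp
  show ?case
  proof (cases "i = 0")
    case True
    then show ?thesis using Cons[of 0] rec by auto
  next
    case False
    consider "j \<le> i + 1 \<and> i \<le> j + length ks" | "i = j + length ks + 1"
      | "j > i + 1 \<or> i > j + length ks + 1" by linarith
    then show ?thesis
    proof cases
      case 1
      then have "M ks i j > 0" using Cons[of i] by simp
      moreover have "\<alpha> (k + 1 + (i - 1) * (p + 1)) * M ks (i - 1) j \<ge> 0"
        using c nonneg by (intro mult_nonneg_nonneg) auto
      ultimately have "M (k # ks) i j > 0" using rec False by simp
      then show ?thesis using 1 by simp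
    next
      case 2
      then have "M ks (i - 1) j > 0" using Cons[of "i - 1"] by simp
      then have "M (k # ks) i j > 0"
        using rec False nonneg[of i] mult_pos_pos[OF c] by (simp add: add_nonneg_pos)
      then show ?thesis using 2 by simp
    next
      case 3
      then have "M ks i j = 0" "M ks (i - 1) j = 0"
        using Cons[of i] Cons[of "i - 1"] False by (auto split: if_splits)
      then show ?thesis using rec 3 by auto
    qed
  qed
qed

section \<open>The paths lost by truncation\<close>

locale positive_band =
  fixes p :: nat and T :: smat
  assumes band_zero: "j > i + 1 \<or> j + p < i \<Longrightarrow> T i j = 0"
    and band_pos: "j \<le> i + 1 \<Longrightarrow> i \<le> j + p \<Longrightarrow> T i j > 0"
begin

lemma T_nonneg: "T i j \<ge> 0"
  using band_zero[where i = i and j = j] band_pos[where i = i and j = j]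
  by (metis less_eq_real_def not_less)

lemma smat_power_Suc_eq_sum:
  "smat_power T (Suc n) i j = (\<Sum>k\<le>j + p. smat_power T n i k * T k j)"
  by (simp, rule smat_mult_eq_sum) (auto simp: band_zero)

lemma smat_power_nonneg: "smat_power T n i j \<ge> 0"
proof (induction n arbitrary: j)
  case 0
  show ?case by (simp add: smat_one_def)
next
  case (Suc n)
  then show ?case
    unfolding smat_power_Suc_eq_sum by (intro sum_nonneg mult_nonneg_nonneg T_nonneg)
qed

lemma smat_power_eq_0: "j > i + n \<Longrightarrow> smat_power T n i j = 0"
proof (induction n arbitrary: j)
  case 0
  then show ?case by (simp add: smat_one_def)
next
  case (Suc n)
  have zero: "smat_power T n i k * T k j = 0" for k
    using Suc.IH[of k] band_zero[of k j] Suc.prems by (cases "k > i + n") auto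
  show ?case unfolding smat_power_Suc_eq_sum by (simp only: zero sum.neutral_const)
qed

lemma smat_power_superdiagonal_pos: "smat_power T n i (i + n) > 0"
proof (induction n)
  case 0
  show ?case by (simp add: smat_one_def)
next
  case (Suc n)
  have "0 < smat_power T n i (i + n) * T (i + n) (i + Suc n)"
    using Suc by (intro mult_pos_pos band_pos) auto
  also have "\<dots> \<le> smat_power T (Suc n) i (i + Suc n)"
    unfolding smat_power_Suc_eq_sum
    by (rule member_le_sum) (auto intro!: mult_nonneg_nonneg smat_power_nonneg T_nonneg)
  finally show ?case .
qed

text \<open>
  The total weight of the paths from \<open>0\<close> to \<open>j\<close> of \<open>n\<close> steps that leave the sites \<open>0, \<dots>, N\<close>. An end
  point \<open>j > N\<close> is allowed: it makes the quantity satisfy a recursion in \<open>n\<close>.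
\<close>

definition truncation_defect :: "nat \<Rightarrow> nat \<Rightarrow> nat \<Rightarrow> real" where
  "truncation_defect N n j = smat_power T n 0 j -
     (if j \<le> N then (leading_submatrix T N ^\<^sub>m n) $$ (0, j) else 0)"

lemma leading_submatrix_power_carrier:
  "leading_submatrix A N ^\<^sub>m n \<in> carrier_mat (Suc N) (Suc N)"
  by (rule pow_carrier_mat) (simp add: leading_submatrix_def)

lemma leading_submatrix_power_Suc:
  assumes "j \<le> N"
  shows "(leading_submatrix A N ^\<^sub>m Suc n) $$ (0, j) =
    (\<Sum>k\<le>N. (leading_submatrix A N ^\<^sub>m n) $$ (0, k) * A k j)"
proof -
  have A: "leading_submatrix A N \<in> carrier_mat (Suc N) (Suc N)"
    by (simp add: leading_submatrix_def)
  have "(leading_submatrix A N ^\<^sub>m Suc n) $$ (0, j) =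
      (\<Sum>k\<in>{0..<Suc N}. (leading_submatrix A N ^\<^sub>m n) $$ (0, k) * leading_submatrix A N $$ (k, j))"
    using assms carrier_matD[OF A] carrier_matD[OF leading_submatrix_power_carrier[of A N n]]
    by (simp add: scalar_prod_def del: sum.op_ivl_Suc)
  also have "\<dots> = (\<Sum>k\<le>N. (leading_submatrix A N ^\<^sub>m n) $$ (0, k) * A k j)"
    using assms by (intro sum.cong) (auto simp: leading_submatrix_def)
  finally show ?thesis .
qed

lemma leading_submatrix_power_nonneg:
  "j \<le> N \<Longrightarrow> (leading_submatrix T N ^\<^sub>m n) $$ (0, j) \<ge> 0"
proof (induction n arbitrary: j)
  case 0
  then show ?case by (simp add: leading_submatrix_def)
next
  case (Suc n)
  then show ?case
    unfolding leading_submatrix_power_Suc[OF Suc.prems]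
    by (intro sum_nonneg mult_nonneg_nonneg T_nonneg) auto
qed

lemma truncation_defect_0: "truncation_defect N 0 j = 0"
  by (auto simp: truncation_defect_def smat_one_def leading_submatrix_def)

lemma truncation_defect_outside:
  "j > N \<Longrightarrow> truncation_defect N n j = smat_power T n 0 j"
  by (simp add: truncation_defect_def)

lemma truncation_defect_Suc:
  assumes "j \<le> N"
  shows "truncation_defect N (Suc n) j = (\<Sum>k\<le>j + p. truncation_defect N n k * T k j)"
proof -
  let ?B = "leading_submatrix T N"
  let ?s = "\<lambda>k. if k \<le> N then (?B ^\<^sub>m n) $$ (0, k) else 0"
  have "(?B ^\<^sub>m Suc n) $$ (0, j) = (\<Sum>k\<le>N. (?B ^\<^sub>m n) $$ (0, k) * T k j)"
    by (rule leading_submatrix_power_Suc[OF assms])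
  also have "\<dots> = (\<Sum>k\<in>{..N} \<union> {..j + p}. ?s k * T k j)"
    by (rule sum.mono_neutral_cong_left) auto
  also have "\<dots> = (\<Sum>k\<le>j + p. ?s k * T k j)"
    by (rule sum.mono_neutral_right) (auto simp: band_zero)
  finally have "(?B ^\<^sub>m Suc n) $$ (0, j) = (\<Sum>k\<le>j + p. ?s k * T k j)" .
  then show ?thesis
    using assms
    by (simp add: truncation_defect_def smat_power_Suc_eq_sum left_diff_distrib sum_subtractf
        del: smat_power.simps pow_mat.simps)
qed

lemma truncation_defect_nonneg: "truncation_defect N n j \<ge> 0"
proof (induction n arbitrary: j)
  case 0
  show ?case by (simp add: truncation_defect_0)
next
  case (Suc n)
  then show ?case
    by (cases "j \<le> N")
      (auto simp: truncation_defect_Suc truncation_defect_outside smat_power_nonneg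
        simp del: smat_power.simps intro!: sum_nonneg mult_nonneg_nonneg T_nonneg)
qed

text \<open>
  Along a path \<open>n p + j\<close> never decreases, because each step adds \<open>p\<close> to the first summand and takes
  at most \<open>p\<close> from the second. When the path is at a site \<open>j \<ge> N + 1\<close>, it has made
  \<open>n \<ge> N + 1\<close> steps, so that \<open>n p + j \<ge> (N + 1) (p + 1)\<close> from then on.
\<close>

lemma truncation_defect_eq_0:
  "n * p + j < (N + 1) * (p + 1) \<Longrightarrow> truncation_defect N n j = 0"
proof (induction n arbitrary: j)
  case 0
  show ?case by (rule truncation_defect_0)
next
  case (Suc n)
  show ?case
  proof (cases "j \<le> N")
    case True
    have "truncation_defect N n k = 0" if "k \<le> j + p" for k
      using that Suc.prems by (intro Suc.IH) auto
    then show ?thesis using True by (simp add: truncation_defect_Suc)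
  next
    case False
    have "Suc n \<le> N"
    proof (rule ccontr)
      assume "\<not> Suc n \<le> N"
      then have "(N + 1) * p + (N + 1) \<le> Suc n * p + j"
        using False by (intro add_mono mult_le_mono1) auto
      then show False using Suc.prems by (simp add: algebra_simps)
    qed
    then show ?thesis
      using False smat_power_eq_0[of 0 "Suc n" j] by (simp add: truncation_defect_outside)
  qed
qed

text \<open>
  A discarded path stays discarded when it is prolonged by a step from \<open>k\<close> to \<open>j\<close>. For
  \<open>j > N\<close> that step also discards the paths that were inside until then.
\<close>

lemma truncation_defect_Suc_ge:
  assumes "k \<le> j + p"
  shows "truncation_defect N n k * T k j \<le> truncation_defect N (Suc n) j"
proof (cases "j \<le> N")
  case True
  show ?thesis
    unfolding truncation_defect_Suc[OF True] using assms
    by (intro member_le_sum) (auto intro!: mult_nonneg_nonneg truncation_defect_nonneg T_nonneg)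
next
  case False
  have "truncation_defect N n k \<le> smat_power T n 0 k"
    using leading_submatrix_power_nonneg[of k N n] by (auto simp: truncation_defect_def)
  then have "truncation_defect N n k * T k j \<le> smat_power T n 0 k * T k j"
    by (intro mult_right_mono T_nonneg)
  also have "\<dots> \<le> smat_power T (Suc n) 0 j"
    unfolding smat_power_Suc_eq_sum using assms
    by (intro member_le_sum) (auto intro!: mult_nonneg_nonneg smat_power_nonneg T_nonneg)
  finally show ?thesis using False by (simp add: truncation_defect_outside)
qed

text \<open>
  Following the shortest path: it is at \<open>N + 1\<close> after \<open>N + 1\<close> steps, and the remaining \<open>m\<close> steps
  suffice to come down to \<open>j\<close>. Its predecessor at \<open>min (N + 1) (j + p)\<close> allows for an idle step at
  \<open>N + 1\<close> when there is time to spare.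
\<close>

lemma truncation_defect_pos:
  assumes "j \<le> N + 1" "N + 1 \<le> m * p + j"
  shows "truncation_defect N (N + 1 + m) j > 0"
  using assms
proof (induction m arbitrary: j)
  case 0
  then have "j = N + 1" by simp
  then show ?case
    using smat_power_superdiagonal_pos[of "N + 1" 0] by (simp add: truncation_defect_outside)
next
  case (Suc m)
  define k where "k = min (N + 1) (j + p)"
  have "truncation_defect N (N + 1 + m) k > 0"
    using Suc.prems by (intro Suc.IH) (auto simp: k_def min_def algebra_simps)
  moreover have "T k j > 0"
    using Suc.prems by (intro band_pos) (auto simp: k_def)
  ultimately have "0 < truncation_defect N (N + 1 + m) k * T k j" by simp
  also have "\<dots> \<le> truncation_defect N (Suc (N + 1 + m)) j"
    by (rule truncation_defect_Suc_ge) (simp add: k_def)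
  finally show ?case by simp
qed

lemma moment_minus_truncated_moment:
  assumes "p \<le> N + 1"
  shows "moment p T \<nu> a n - truncated_moment p T \<nu> N a n =
    (\<Sum>j<p. truncation_defect N n j * e_nu p \<nu> a j)"
proof -
  let ?v = "e_nu p \<nu> a" and ?B = "leading_submatrix T N ^\<^sub>m n"
  have out: "?v j = 0" if "j \<ge> p" for j using that by (simp add: e_nu_def)
  have "smat_mult_vec (smat_power T n) ?v 0 = (\<Sum>j<p. smat_power T n 0 j * ?v j)"
    unfolding smat_mult_vec_def by (rule suminf_finite) (auto simp: out)
  moreover have "svec_scalar_prod (sunit_vec 0) u = u 0" for u :: svec
  proof -
    have "svec_scalar_prod (sunit_vec 0) u = (\<Sum>i\<in>{0}. sunit_vec 0 i * u i)"
      unfolding svec_scalar_prod_def by (rule suminf_finite) (auto simp: sunit_vec_def)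
    then show ?thesis by (simp add: sunit_vec_def)
  qed
  ultimately have m: "moment p T \<nu> a n = (\<Sum>j<p. smat_power T n 0 j * ?v j)"
    by (simp add: moment_def)
  have "truncated_moment p T \<nu> N a n = (?B *\<^sub>v vec (N + 1) ?v) $ 0"
    unfolding truncated_moment_def using leading_submatrix_power_carrier[of T N n]
    by (intro scalar_prod_left_unit) auto
  also have "\<dots> = (\<Sum>j<N + 1. ?B $$ (0, j) * ?v j)"
    using carrier_matD[OF leading_submatrix_power_carrier[of T N n]]
    by (simp add: scalar_prod_def lessThan_atLeast0 del: sum.op_ivl_Suc)
  also have "\<dots> = (\<Sum>j<p. ?B $$ (0, j) * ?v j)"
    using assms by (intro sum.mono_neutral_right) (auto simp: out)
  finally have "truncated_moment p T \<nu> N a n = (\<Sum>j<p. ?B $$ (0, j) * ?v j)" .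
  then show ?thesis
    unfolding m using assms
    by (auto simp: truncation_defect_def sum_subtractf[symmetric] left_diff_distrib
        intro!: sum.cong)
qed

end

section \<open>Positivity of the initial vectors\<close>

lemma foldr_mult_carrier_mat:
  "(\<And>k. A k \<in> carrier_mat n n) \<Longrightarrow>
    foldr (*) (map A ks) (1\<^sub>m n) \<in> carrier_mat n n"
  by (induction ks) (auto intro: mult_carrier_mat[where n = n])

text \<open>
  Each factor pushes the support of a nonnegative vector down by one row, so the product of \<open>r\<close>
  factors maps the first canonical vector to one supported exactly on the rows \<open>0, \<dots>, r\<close>.
\<close>

lemma bidiagonal_product_unit_vec:
  fixes \<alpha> :: "nat \<Rightarrow> real" and p :: nat
  assumes pos: "\<And>i. i \<ge> 1 \<Longrightarrow> \<alpha> i > 0" and "p \<ge> 1"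
  defines "A \<equiv> \<lambda>k. leading_submatrix (L_factor p \<alpha> k) (p - 1)"
  defines "w \<equiv> \<lambda>ks. foldr (*) (map A ks) (1\<^sub>m p) *\<^sub>v unit_vec p 0"
  assumes "i < p"
  shows "if i \<le> length ks then w ks $ i > 0 else w ks $ i = 0"
  using \<open>i < p\<close>
proof (induction ks arbitrary: i)
  case Nil
  then show ?case by (simp add: w_def)
next
  case (Cons k ks)
  have A: "A k \<in> carrier_mat p p" for k
    using \<open>p \<ge> 1\<close> by (simp add: A_def leading_submatrix_def)
  note P = foldr_mult_carrier_mat[of A, OF A]
  have w_dim: "w ks \<in> carrier_vec p"
    unfolding w_def by (rule mult_mat_vec_carrier[OF P]) simp
  let ?c = "\<alpha> (k + 1 + (i - 1) * (p + 1))"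
  have "w (k # ks) = A k *\<^sub>v w ks"
    unfolding w_def by (simp add: assoc_mult_mat_vec[OF A P])
  then have "w (k # ks) $ i = (\<Sum>l<p. L_factor p \<alpha> k i l * w ks $ l)"
    using w_dim \<open>i < p\<close> \<open>p \<ge> 1\<close>
    by (auto simp: A_def leading_submatrix_def scalar_prod_def lessThan_atLeast0
        intro!: sum.cong)
  also have "\<dots> = (\<Sum>l\<in>{i, i - 1}. L_factor p \<alpha> k i l * w ks $ l)"
    using \<open>i < p\<close> by (intro sum.mono_neutral_right) (auto simp: L_factor_def)
  also have "\<dots> = w ks $ i + (if i = 0 then 0 else ?c * w ks $ (i - 1))"
    by (cases i) (auto simp: L_factor_def)
  finally have rec: "w (k # ks) $ i = w ks $ i + (if i = 0 then 0 else ?c * w ks $ (i - 1))" .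
  have c: "?c > 0" by (rule pos) simp
  have IH: "if i \<le> length ks then w ks $ i > 0 else w ks $ i = 0"
    "if i - 1 \<le> length ks then w ks $ (i - 1) > 0 else w ks $ (i - 1) = 0"
    using Cons.IH[of i] Cons.IH[of "i - 1"] \<open>i < p\<close> by auto
  show ?case
  proof (cases "i \<le> length (k # ks)")
    case True
    then have "i = 0 \<or> w ks $ (i - 1) > 0" using IH(2) by (auto split: if_splits)
    then have "i = 0 \<or> ?c * w ks $ (i - 1) > 0" using mult_pos_pos[OF c] by blast
    then have "w (k # ks) $ i > 0" using rec IH(1) by (auto split: if_splits)
    then show ?thesis using True by simp
  next
    case False
    then have "w ks $ i = 0" "w ks $ (i - 1) = 0"
      using IH by (auto split: if_splits)
    then show ?thesis using rec False by simp
  qed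
qed

lemma scriptL_entry:
  fixes \<alpha> :: "nat \<Rightarrow> real"
  assumes pos: "\<And>i. i \<ge> 1 \<Longrightarrow> \<alpha> i > 0" and "i < p" "k < p"
  shows "if i \<le> k then scriptL p \<alpha> $$ (i, k) > 0 else scriptL p \<alpha> $$ (i, k) = 0"
proof -
  let ?w = "foldr (*) (map (\<lambda>i. leading_submatrix (L_factor p \<alpha> i) (p - 1)) [1..<Suc k]) (1\<^sub>m p)
         *\<^sub>v unit_vec p 0"
  have "?w \<in> carrier_vec p"
    using assms
    by (intro mult_mat_vec_carrier[OF foldr_mult_carrier_mat]) (auto simp: leading_submatrix_def)
  moreover have "scriptL p \<alpha> $$ (i, k) = scriptL_col p \<alpha> (Suc k) $ i"
    using assms by (simp add: scriptL_def mat_of_cols_def del: upt_Suc)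
  ultimately have "scriptL p \<alpha> $$ (i, k) = ?w $ i / scriptL_norm p \<alpha> (Suc k)"
    using \<open>i < p\<close> unfolding scriptL_col_def by (simp only: index_smult_vec carrier_vecD) simp
  moreover have "scriptL_norm p \<alpha> (Suc k) > 0"
    unfolding scriptL_norm_def by (intro prod_pos ballI pos) simp
  moreover have "if i \<le> k then ?w $ i > 0 else ?w $ i = 0"
    using bidiagonal_product_unit_vec[of \<alpha> p i "[1..<Suc k]"] assms by (simp del: upt_Suc)
  ultimately show ?thesis by (auto split: if_splits)
qed

lemma e_nu_sign:
  fixes \<alpha> :: "nat \<Rightarrow> real"
  assumes pos: "\<And>i. i \<ge> 1 \<Longrightarrow> \<alpha> i > 0"
    and C: "upper_unitriangular p C" "nonnegative_mat C"
    and \<nu>: "inverse_transpose \<nu> = scriptL p \<alpha> * C"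
    and a: "a \<in> {1..p}"
  shows "e_nu p \<nu> a j \<ge> 0" and "j \<ge> a \<Longrightarrow> e_nu p \<nu> a j = 0" and "e_nu p \<nu> a (a - 1) > 0"
proof -
  let ?L = "scriptL p \<alpha>"
  have Cdim: "C \<in> carrier_mat p p" and Ctri: "upper_triangular C"
    and Cdiag: "\<And>i. i < p \<Longrightarrow> C $$ (i, i) = 1"
    using C(1) by (auto simp: upper_unitriangular_def)
  have Ldim: "?L \<in> carrier_mat p p"
    using mat_of_cols_carrier(1)[of p "map (scriptL_col p \<alpha>) [1..<p + 1]"]
    by (simp add: scriptL_def del: upt_Suc mat_of_cols_carrier)
  have LC: "?L * C \<in> carrier_mat p p" using Ldim Cdim by (rule mult_carrier_mat)
  have entry: "e_nu p \<nu> a j = (\<Sum>k<p. ?L $$ (j, k) * C $$ (k, a - 1))" if "j < p" for j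
  proof -
    have "(M *\<^sub>v unit_vec p (a - 1)) $ j = M $$ (j, a - 1)" if "M \<in> carrier_mat p p"
      for M :: "real mat"
      using that \<open>j < p\<close> a by auto
    from this[OF LC] have "e_nu p \<nu> a j = (?L * C) $$ (j, a - 1)"
      using \<open>j < p\<close> unfolding e_nu_def \<nu> by (simp only: if_True)
    also have "\<dots> = (\<Sum>k<p. ?L $$ (j, k) * C $$ (k, a - 1))"
      using Ldim Cdim a that
      by (auto simp: scalar_prod_def lessThan_atLeast0 intro!: sum.cong)
    finally show ?thesis .
  qed
  have L: "if i \<le> k then ?L $$ (i, k) > 0 else ?L $$ (i, k) = 0" if "i < p" "k < p" for i k
    using scriptL_entry[of \<alpha>, OF pos that] .
  have terms: "?L $$ (j, k) * C $$ (k, a - 1) \<ge> 0" if "j < p" "k < p" for j k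
    using L[OF that] C(2) Cdim that a
    by (intro mult_nonneg_nonneg) (auto simp: nonnegative_mat_def split: if_splits)
  show "e_nu p \<nu> a j \<ge> 0"
  proof (cases "j < p")
    case True
    then show ?thesis unfolding entry[OF True] by (intro sum_nonneg terms) auto
  qed (simp add: e_nu_def)
  show "e_nu p \<nu> a j = 0" if "j \<ge> a"
  proof (cases "j < p")
    case True
    have "?L $$ (j, k) * C $$ (k, a - 1) = 0" if "k < p" for k
    proof (cases "k < j")
      case True
      then show ?thesis using L[OF \<open>j < p\<close> that] by simp
    next
      case False
      then have "a - 1 < k" using \<open>j \<ge> a\<close> a by auto
      then have "C $$ (k, a - 1) = 0"
        using Ctri Cdim that by (auto simp: upper_triangular_def)
      then show ?thesis by simp
    qed
    then show ?thesis unfolding entry[OF True] by (intro sum.neutral) blast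
  qed (simp add: e_nu_def)
  have a': "a - 1 < p" using a by auto
  have "0 < ?L $$ (a - 1, a - 1) * C $$ (a - 1, a - 1)"
    using L[OF a' a'] Cdiag[OF a'] by simp
  also have "\<dots> \<le> (\<Sum>k<p. ?L $$ (a - 1, k) * C $$ (k, a - 1))"
    using a' by (intro member_le_sum) (auto simp del: One_nat_def intro: terms)
  finally show "e_nu p \<nu> a (a - 1) > 0" using entry[OF a'] by simp
qed

section \<open>The degrees of precision\<close>

lemma is_degree_of_precisionI:
  assumes "\<And>n. n \<le> d \<Longrightarrow> moment p T \<nu> a n = truncated_moment p T \<nu> N a n"
    and "moment p T \<nu> a (Suc d) \<noteq> truncated_moment p T \<nu> N a (Suc d)"
  shows "is_degree_of_precision p T \<nu> N a d"
  unfolding is_degree_of_precision_def using assms by (meson not_less_eq_eq)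

theorem proposition18:
  fixes p N a nodes :: nat
    and T :: smat
    and \<alpha> :: "nat \<Rightarrow> real"
    and \<nu> C :: "real mat"
  assumes "p \<ge> 1"
    and "monic_banded_Hessenberg p T"
    and "bounded_smat T"
    and "positive_bidiagonal_factorization p T \<alpha>"
    and "lower_unitriangular p \<nu>"
    and "upper_unitriangular p C"
    and "nonnegative_mat C"
    and "inverse_transpose \<nu> = scriptL p \<alpha> * C"
    and "N \<ge> p - 1"
    and "nodes = N + 1"
    and "a \<in> {1..p}"
  shows "\<exists>d. is_degree_of_precision p T \<nu> N a d \<and>
           int d = int nodes - 1 + \<lceil>(real nodes + 1 - real a) / real p\<rceil>"
proof -
  have pos: "\<And>i. i \<ge> 1 \<Longrightarrow> \<alpha> i > 0"
    and T: "T = foldr smat_mult (map (L_factor p \<alpha>) [1..<p + 1]) (U_factor p \<alpha>)"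
    using assms(4) by (auto simp: positive_bidiagonal_factorization_def)
  have band: "if j \<le> i + 1 \<and> i \<le> j + p then T i j > 0 else T i j = 0" for i j
    using band_of_bidiagonal_product[of \<alpha> j i "[1..<p + 1]" p, OF pos] unfolding T[symmetric]
    by (simp del: upt_Suc)
  interpret positive_band p T
    using band by unfold_locales (metis not_less, metis)
  let ?v = "e_nu p \<nu> a"
  note v = e_nu_sign[of \<alpha>, OF pos assms(6-8) \<open>a \<in> {1..p}\<close>]
  have pN: "p \<le> N + 1" and a: "a \<ge> 1" "a \<le> p" using assms by auto

  (* The number of down steps that lead from N + 1 to a - 1. *)
  define x where "x = (real nodes + 1 - real a) / real p"
  define c where "c = nat \<lceil>x\<rceil>"
  have "x > 0" using a pN assms(1,10) by (simp add: x_def)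
  then have c: "int c = \<lceil>x\<rceil>" by (simp add: c_def)
  have "real c - 1 < x \<and> x \<le> real c"
    using ceiling_correct[of x] c by (metis of_int_of_nat_eq)
  then have "(real c - 1) * real p < real N + 2 - real a \<and> real N + 2 - real a \<le> real c * real p"
    using assms(1,10) by (simp add: x_def field_simps)
  then have "real (c * p + a) < real (N + 2 + p)" "real (N + 2) \<le> real (c * p + a)"
    by (simp_all add: algebra_simps)
  then have c_upper: "c * p + a < N + 2 + p" and c_lower: "N + 2 \<le> c * p + a"
    by (simp_all only: of_nat_less_iff of_nat_le_iff)

  have "is_degree_of_precision p T \<nu> N a (N + c)"
  proof (rule is_degree_of_precisionI)
    fix n assume "n \<le> N + c"
    then have n: "n * p \<le> (N + c) * p" by (rule mult_le_mono1)
    have zero: "truncation_defect N n j * ?v j = 0" for j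
    proof (cases "j < a")
      case True
      then have "n * p + j < (N + 1) * (p + 1)"
        using n c_upper by (simp add: algebra_simps)
      then show ?thesis by (simp add: truncation_defect_eq_0)
    qed (simp add: v(2))
    show "moment p T \<nu> a n = truncated_moment p T \<nu> N a n"
      using moment_minus_truncated_moment[OF pN, of \<nu> a n]
      by (simp only: zero sum.neutral_const right_minus_eq)
  next
    have "0 < truncation_defect N (N + 1 + c) (a - 1) * ?v (a - 1)"
      using a pN c_lower by (intro mult_pos_pos v(3) truncation_defect_pos) auto
    also have "\<dots> \<le> (\<Sum>j<p. truncation_defect N (N + 1 + c) j * ?v j)"
      using a by (intro member_le_sum) (auto intro!: mult_nonneg_nonneg truncation_defect_nonneg v(1))
    finally show "moment p T \<nu> a (Suc (N + c)) \<noteq> truncated_moment p T \<nu> N a (Suc (N + c))"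
      using moment_minus_truncated_moment[OF pN, of \<nu> a "Suc (N + c)"] by simp
  qed
  moreover have "int (N + c) = int nodes - 1 + \<lceil>(real nodes + 1 - real a) / real p\<rceil>"
    using c assms(10) by (simp add: x_def)
  ultimately show ?thesis by blast
qed

end
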